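(* For any pair of semantically equivalent aleatoric calculus formulae $\varphi$ and $\psi$, the statement $\varphi \simeq \psi$ is derivable in the axiom system $\mathfrak{AC}$ (i.e. $\mathfrak{AC}$ is complete for the aleatoric calculus).
   Context: Aleatoric calculus formulae over a set $X$ of random variables are generated by $\alpha ::= x \mid \top \mid \bot \mid (\alpha\,?\,\alpha:\alpha)$ with $x \in X$. A valuation $P : X \to [0,1]$ extends to all formulae by $P(\top)=1$, $P(\bot)=0$, $P(\alpha\,?\,\beta:\gamma) = P(\alpha)P(\beta) + (1-P(\alpha))P(\gamma)$; $\varphi$ and $\psi$ are semantically equivalent if $P(\varphi)=P(\psi)$ for every valuation $P$ (equivalently, at every world of every probability model, since the value of such a formula at a world depends only on the probabilities assigned to the variables there). The system $\mathfrak{AC}$ derives statements $\alpha \simeq \beta$. Its axioms, for variables $x,y,z,p,q,r,s \in X$, are: $\mathbf{id}$: $x \simeq x$; $\mathbf{vacuous}$: $(x\,?\,\top:\bot) \simeq x$; $\mathbf{ignore}$: $(x\,?\,y:y) \simeq y$; $\mathbf{always}$: $(\top\,?\,x:y)\simeq x$; $\mathbf{never}$: $(\bot\,?\,x:y) \simeq y$; $\mathbf{tree}$: $((x\,?\,y:z)\,?\,p:q) \simeq (x\,?\,(y\,?\,p:q):(z\,?\,p:q))$; $\mathbf{swap}$: $(x\,?\,(y\,?\,p:q):(y\,?\,r:s)) \simeq (y\,?\,(x\,?\,p:r):(x\,?\,q:s))$. Its rules are: Trans (from $\alpha\simeq\beta$ and $\beta\simeq\gamma$ infer $\alpha\simeq\gamma$);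 Sym (from $\alpha\simeq\beta$ infer $\beta\simeq\alpha$); Subs (from $\alpha\simeq\beta$ and $\gamma\simeq\delta$ infer $\alpha[x\backslash\gamma]\simeq\beta[x\backslash\delta]$, where $\alpha[x\backslash\gamma]$ replaces every occurrence of the variable $x$ by $\gamma$).
   Formalization: The axiom id is taken as reflexivity α ≃ α for all formulae (for variables only, ⊤ ≃ ⊤ would not be derivable), and the set X of random variables is assumed infinite, so that Subs has fresh variables; the other axioms and rules are as stated. *)

theory Defs
  imports Complex_Main
begin

datatype 'v formula =
    Var 'v
  | Top
  | Bot
  | Cond "'v formula" "'v formula" "'v formula"

definition valuation :: "('v \<Rightarrow> real) \<Rightarrow> bool" where
  "valuation P \<longleftrightarrow> (\<forall>x. P x \<in> {0..1})"

primrec prob :: "('v \<Rightarrow> real) \<Rightarrow> 'v formula \<Rightarrow> real" where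
  "prob P (Var x) = P x"
| "prob P Top = 1"
| "prob P Bot = 0"
| "prob P (Cond \<alpha> \<beta> \<gamma>) = prob P \<alpha> * prob P \<beta> + (1 - prob P \<alpha>) * prob P \<gamma>"

definition sem_equiv :: "'v formula \<Rightarrow> 'v formula \<Rightarrow> bool" where
  "sem_equiv \<phi> \<psi> \<longleftrightarrow> (\<forall>P. valuation P \<longrightarrow> prob P \<phi> = prob P \<psi>)"

primrec subst :: "'v formula \<Rightarrow> 'v \<Rightarrow> 'v formula \<Rightarrow> 'v formula" where
  "subst (Var y) x \<gamma> = (if y = x then \<gamma> else Var y)"
| "subst Top x \<gamma> = Top"
| "subst Bot x \<gamma> = Bot"
| "subst (Cond \<alpha> \<beta> \<delta>) x \<gamma> = Cond (subst \<alpha> x \<gamma>) (subst \<beta> x \<gamma>) (subst \<delta> x \<gamma>)"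

text \<open>
  All axioms except \<open>id\<close> are stated for variables only; other instances come from \<open>Subs\<close>.
  The axiom \<open>id\<close> is reflexivity for every formula. Restricted to variables it would be
  too weak: by induction on derivations no statement with \<open>Top\<close>, \<open>Bot\<close> or
  \<open>Cond (Var x) (Var y) (Var z)\<close> (\<open>x\<close>, \<open>y\<close>, \<open>z\<close> distinct) as one side would be derivable, since
  no axiom has such a side and \<open>Subs\<close> only produces one from an earlier one.
  In particular \<open>Top \<simeq> Top\<close> would not be derivable.
\<close>

inductive AC :: "'v formula \<Rightarrow> 'v formula \<Rightarrow> bool"  (infix "\<simeq>" 50) where
  id: "\<alpha> \<simeq> \<alpha>"
| vacuous: "Cond (Var x) Top Bot \<simeq> Var x"
| ignore: "Cond (Var x) (Var y) (Var y) \<simeq> Var y"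
| always: "Cond Top (Var x) (Var y) \<simeq> Var x"
| never: "Cond Bot (Var x) (Var y) \<simeq> Var y"
| tree: "Cond (Cond (Var x) (Var y) (Var z)) (Var p) (Var q) \<simeq>
         Cond (Var x) (Cond (Var y) (Var p) (Var q)) (Cond (Var z) (Var p) (Var q))"
| swap: "Cond (Var x) (Cond (Var y) (Var p) (Var q)) (Cond (Var y) (Var r) (Var s)) \<simeq>
         Cond (Var y) (Cond (Var x) (Var p) (Var r)) (Cond (Var x) (Var q) (Var s))"
| Trans: "\<alpha> \<simeq> \<beta> \<Longrightarrow> \<beta> \<simeq> \<gamma> \<Longrightarrow> \<alpha> \<simeq> \<gamma>"
| Sym: "\<alpha> \<simeq> \<beta> \<Longrightarrow> \<beta> \<simeq> \<alpha>"
| Subs: "\<alpha> \<simeq> \<beta> \<Longrightarrow> \<gamma> \<simeq> \<delta> \<Longrightarrow> subst \<alpha> x \<gamma> \<simeq> subst \<beta> x \<delta>"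

end

theory Submission
  imports Defs "HOL-Library.Multiset"
begin

text \<open>
  Every formula is provably equal to a complete decision tree that tosses finitely many coins, each
  labelled by a variable, and has leaves \<open>Top\<close> and \<open>Bot\<close>; two formulas can be expanded over the
  same coins. A leaf is reached with a probability depending only on the multiset of labels of the
  coins showing heads (its type), and \<open>swap\<close> lets one exchange any two leaves of the same type. Hence
  the tree is determined up to provable equality by the number of \<open>Top\<close> leaves of each type. These
  numbers are the coefficients of the denoted polynomial in the (tensor) Bernstein basis, so they
  are determined by the semantics.
\<close>

section \<open>Substitution and soundness\<close>

declare AC.Trans [trans]

lemma subst_fresh [simp]: "x \<notin> set_formula \<alpha> \<Longrightarrow> subst \<alpha> x \<gamma> = \<alpha>"
  by (induction \<alpha>) auto

lemma finite_set_formula [simp]: "finite (set_formula \<alpha>)"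
  by (induction \<alpha>) auto

lemma prob_subst: "prob P (subst \<alpha> x \<gamma>) = prob (P(x := prob P \<gamma>)) \<alpha>"
  by (induction \<alpha>) auto

text \<open>The rule \<open>Subs\<close> evaluates its premise at a valuation updated in
  \<open>x\<close>, so the induction ranges over all \<open>P\<close>. Soundness later passes the
  semantic equivalence of two formulas on to their normal forms.\<close>

lemma AC_sound: "\<alpha> \<simeq> \<beta> \<Longrightarrow> prob P \<alpha> = prob P \<beta>"
  by (induction arbitrary: P rule: AC.induct) (simp_all add: prob_subst algebra_simps)

section \<open>Congruence, and the axioms for arbitrary formulas\<close>

lemma ex_fresh_list:
  assumes "infinite (UNIV :: 'v set)" "finite (A :: 'v set)"
  shows "\<exists>xs. length xs = n \<and> distinct xs \<and> set xs \<inter> A = {}"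
proof -
  have "infinite (- A)"
    using assms by (simp add: Compl_eq_Diff_UNIV)
  then obtain B where "finite B" "card B = n" "B \<subseteq> - A"
    using infinite_arbitrarily_large by blast
  moreover obtain xs where "set xs = B" "distinct xs"
    using \<open>finite B\<close> finite_distinct_list by blast
  ultimately show ?thesis
    using distinct_card[of xs] by (intro exI[of _ xs]) auto
qed

text \<open>Congruence comes from \<open>Subs\<close>, applied one variable at a time to the
  reflexive instance at \<open>Cond (Var x) (Var y) (Var z)\<close>. A variable still to be replaced
  must not occur in a formula inserted before it; an infinite supply of variables provides such
  fresh ones. The axioms in several variables are lifted to formulas in the same way.\<close>

lemma AC_Cond:
  assumes inf: "infinite (UNIV :: 'v set)"
    and "(a :: 'v formula) \<simeq> a'" "b \<simeq> b'" "c \<simeq> c'"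
  shows "Cond a b c \<simeq> Cond a' b' c'"
proof -
  obtain xs where xs: "length xs = 3" "distinct xs"
    "set xs \<inter> (set_formula a \<union> set_formula a' \<union> set_formula b \<union> set_formula b') = {}"
    using ex_fresh_list[OF inf,
        of "set_formula a \<union> set_formula a' \<union> set_formula b \<union> set_formula b'" 3] by auto
  then obtain x y z where "xs = [x, y, z]"
    by (auto simp: numeral_3_eq_3 length_Suc_conv)
  with xs show ?thesis
    using AC.Subs[OF AC.Subs[OF AC.Subs[OF AC.id[of "Cond (Var x) (Var y) (Var z)"]
          assms(2), of x] assms(3), of y] assms(4), of z]
    by auto
qed

lemma AC_vacuous: "Cond a Top Bot \<simeq> a"
  using AC.Subs[OF AC.vacuous[of undefined] AC.id[of a], of undefined] by simp

lemma AC_ignore: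
  assumes inf: "infinite (UNIV :: 'v set)"
  shows "Cond (a :: 'v formula) b b \<simeq> b"
proof -
  obtain xs where xs: "length xs = 2" "distinct xs" "set xs \<inter> set_formula a = {}"
    using ex_fresh_list[OF inf, of "set_formula a" 2] by auto
  then obtain x y where "xs = [x, y]"
    by (auto simp: numeral_2_eq_2 length_Suc_conv)
  with xs show ?thesis
    using AC.Subs[OF AC.Subs[OF AC.ignore[of x y] AC.id[of a], of x] AC.id[of b], of y] by auto
qed

lemma AC_always:
  assumes inf: "infinite (UNIV :: 'v set)"
  shows "Cond Top (a :: 'v formula) b \<simeq> a"
proof -
  obtain xs where xs: "length xs = 2" "distinct xs" "set xs \<inter> set_formula a = {}"
    using ex_fresh_list[OF inf, of "set_formula a" 2] by auto
  then obtain x y where "xs = [x, y]"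
    by (auto simp: numeral_2_eq_2 length_Suc_conv)
  with xs show ?thesis
    using AC.Subs[OF AC.Subs[OF AC.always[of x y] AC.id[of a], of x] AC.id[of b], of y] by auto
qed

lemma AC_never:
  assumes inf: "infinite (UNIV :: 'v set)"
  shows "Cond Bot (a :: 'v formula) b \<simeq> b"
proof -
  obtain xs where xs: "length xs = 2" "distinct xs" "set xs \<inter> set_formula a = {}"
    using ex_fresh_list[OF inf, of "set_formula a" 2] by auto
  then obtain x y where "xs = [x, y]"
    by (auto simp: numeral_2_eq_2 length_Suc_conv)
  with xs show ?thesis
    using AC.Subs[OF AC.Subs[OF AC.never[of x y] AC.id[of a], of x] AC.id[of b], of y] by auto
qed

lemma AC_tree:
  assumes inf: "infinite (UNIV :: 'v set)"
  shows "Cond (Cond (a :: 'v formula) b c) d e \<simeq> Cond a (Cond b d e) (Cond c d e)"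
proof -
  let ?A = "set_formula a \<union> set_formula b \<union> set_formula c \<union> set_formula d"
  obtain xs where xs: "length xs = 5" "distinct xs" "set xs \<inter> ?A = {}"
    using ex_fresh_list[OF inf, of ?A 5] by auto
  then obtain x y z p q where "xs = [x, y, z, p, q]"
    by (auto simp: eval_nat_numeral length_Suc_conv)
  with xs show ?thesis
    using AC.Subs[OF AC.Subs[OF AC.Subs[OF AC.Subs[OF AC.Subs[OF AC.tree[of x y z p q]
      AC.id[of a], of x] AC.id[of b], of y] AC.id[of c], of z] AC.id[of d], of p] AC.id[of e], of q]
    by auto
qed

lemma AC_swap:
  assumes inf: "infinite (UNIV :: 'v set)"
  shows "Cond (a :: 'v formula) (Cond b c d) (Cond b e f) \<simeq> Cond b (Cond a c e) (Cond a d f)"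
proof -
  let ?A = "set_formula a \<union> set_formula b \<union> set_formula c \<union> set_formula d \<union> set_formula e"
  obtain xs where xs: "length xs = 6" "distinct xs" "set xs \<inter> ?A = {}"
    using ex_fresh_list[OF inf, of ?A 6] by auto
  then obtain x y p q r s where "xs = [x, y, p, q, r, s]"
    by (auto simp: eval_nat_numeral length_Suc_conv)
  with xs show ?thesis
    using AC.Subs[OF AC.Subs[OF AC.Subs[OF AC.Subs[OF AC.Subs[OF AC.Subs[OF AC.swap[of x y p q r s]
      AC.id[of a], of x] AC.id[of b], of y] AC.id[of c], of p] AC.id[of d], of q]
      AC.id[of e], of r] AC.id[of f], of s]
    by auto
qed

section \<open>Trees of coin tosses\<close>

text \<open>The pair \<open>(v, n)\<close> is the \<open>n\<close>-th coin of the variable \<open>v\<close>; the leaf function receives the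
  set of coins showing heads, so that reordering the coins leaves it unchanged.\<close>

primrec tree :: "('v \<times> nat) list \<Rightarrow> (('v \<times> nat) set \<Rightarrow> 'v formula) \<Rightarrow> 'v formula" where
  "tree [] f = f {}"
| "tree (i # is) f = Cond (Var (fst i)) (tree is (\<lambda>S. f (insert i S))) (tree is f)"

lemma tree_append: "tree (is @ js) f = tree is (\<lambda>S. tree js (\<lambda>R. f (S \<union> R)))"
  by (induction "is" arbitrary: f) auto

lemma tree_cong:
  assumes inf: "infinite (UNIV :: 'v set)"
  shows "(\<And>S. S \<subseteq> set is \<Longrightarrow> f S \<simeq> (g S :: 'v formula)) \<Longrightarrow> tree is f \<simeq> tree is g"
proof (induction "is" arbitrary: f g)
  case (Cons i "is")
  then show ?case
    by (auto intro!: AC_Cond[OF inf] AC.id Cons.IH Cons.prems)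
qed simp

lemma tree_const:
  assumes inf: "infinite (UNIV :: 'v set)"
  shows "tree is (\<lambda>_. a :: 'v formula) \<simeq> a"
proof (induction "is")
  case (Cons i "is")
  then show ?case
    by (auto intro: AC.Trans[OF AC_Cond[OF inf AC.id] AC_ignore[OF inf]])
qed (simp add: AC.id)

text \<open>Iterating the axiom \<open>tree\<close> pulls the coins of the condition to the top, so
  that each branch is left with a conditional on one leaf.\<close>

lemma Cond_tree:
  assumes inf: "infinite (UNIV :: 'v set)"
  shows "Cond (tree is f) a b \<simeq> tree is (\<lambda>S. Cond (f S) a (b :: 'v formula))"
proof (induction "is" arbitrary: f)
  case (Cons i "is")
  then show ?case
    by (auto intro: AC.Trans[OF AC_tree[OF inf] AC_Cond[OF inf AC.id]])
qed (simp add: AC.id)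

lemma tree_move_front:
  assumes inf: "infinite (UNIV :: 'v set)"
  shows "tree (is @ i # js) f \<simeq> (tree (i # is @ js) f :: 'v formula)"
proof (induction "is" arbitrary: f)
  case (Cons k "is")
  have "tree ((k # is) @ i # js) f \<simeq>
    Cond (Var (fst k)) (tree (i # is @ js) (\<lambda>S. f (insert k S))) (tree (i # is @ js) f)"
    using AC_Cond[OF inf AC.id Cons.IH Cons.IH] by simp
  \<comment> \<open>The axiom \<open>swap\<close> exchanges the two topmost coins; the leaves still
    match because heads are recorded as a set.\<close>
  also have "\<dots> \<simeq> tree (i # (k # is) @ js) f"
    using AC_swap[OF inf] by (simp add: insert_commute)
  finally show ?case .
qed (simp add: AC.id)

lemma tree_perm:
  assumes inf: "infinite (UNIV :: 'v set)"
  shows "mset is = mset js \<Longrightarrow> tree is f \<simeq> (tree js f :: 'v formula)"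
proof (induction "is" arbitrary: js f)
  case (Cons i "is")
  have "i \<in> set js"
    using Cons.prems by (metis list.set_intros(1) set_mset_mset)
  then obtain ks ls where js: "js = ks @ i # ls"
    by (meson split_list)
  then have "mset is = mset (ks @ ls)"
    using Cons.prems by simp
  then have "tree (i # is) f \<simeq> tree (i # ks @ ls) f"
    using AC_Cond[OF inf AC.id] Cons.IH by simp
  with AC.Sym[OF tree_move_front[OF inf]] show ?case
    unfolding js by (rule AC.Trans[rotated])
qed (simp add: AC.id)

section \<open>Exchanging leaves of the same type\<close>

abbreviation exchange :: "('a \<Rightarrow> 'b) \<Rightarrow> 'a \<Rightarrow> 'a \<Rightarrow> 'a \<Rightarrow> 'b" where
  "exchange f a b \<equiv> f(a := f b, b := f a)"

text \<open>Moving the two equally labelled coins to the end makes the four leaves below a node of the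
  tree adjacent, so that one instance of \<open>swap\<close> exchanges just two leaves.\<close>

lemma tree_exchange_step:
  assumes inf: "infinite (UNIV :: 'v set)"
    and "distinct is" "i \<in> set is" "j \<in> set is" "i \<noteq> j" "fst i = fst j"
    and S: "S \<subseteq> set is" "i \<notin> S" "j \<notin> S"
  shows "tree is f \<simeq> (tree is (exchange f (insert i S) (insert j S)) :: 'v formula)"
proof -
  define ks where "ks = filter (\<lambda>k. k \<noteq> i \<and> k \<noteq> j) is"
  let ?g = "exchange f (insert i S) (insert j S)"
  have ks: "set ks = set is - {i, j}"
    by (auto simp: ks_def)
  have perm: "mset is = mset (ks @ [i, j])"
    by (rule set_eq_iff_mset_eq_distinct[THEN iffD1]) (use assms ks in \<open>auto simp: ks_def\<close>)
  have "tree [i, j] (\<lambda>Q. f (R \<union> Q)) \<simeq> tree [i, j] (\<lambda>Q. ?g (R \<union> Q))" if R: "R \<subseteq> set ks" for R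
  proof -
    have n: "i \<notin> R" "j \<notin> R"
      using R ks by auto
    have "insert i (insert j R) \<noteq> insert i S" "insert i (insert j R) \<noteq> insert j S"
      using n S \<open>i \<noteq> j\<close> by (metis insertCI insertE)+
    then have 1: "?g R = f R" "?g (insert i (insert j R)) = f (insert i (insert j R))"
      using n by auto
    have inj: "insert k R = insert k S \<longleftrightarrow> R = S" if "k = i \<or> k = j" for k
      using that n S by (metis insert_ident)
    have ne: "insert i R \<noteq> insert j S" "insert j R \<noteq> insert i S"
      using n S \<open>i \<noteq> j\<close> by auto
    show ?thesis
    proof (cases "R = S")
      case True
      have 2: "?g (insert i R) = f (insert j R)" "?g (insert j R) = f (insert i R)"
        using True ne by auto
      \<comment> \<open>Both coins carry the same variable, so \<open>swap\<close> keeps the shape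
        of the tree and only exchanges the two inner leaves, where exactly one of \<open>i\<close>
        and \<open>j\<close> shows heads.\<close>
      show ?thesis
        using AC_swap[OF inf] by (simp add: 1 2 \<open>fst i = fst j\<close> del: fun_upd_apply)
    next
      case False
      then have 2: "?g (insert i R) = f (insert i R)" "?g (insert j R) = f (insert j R)"
        using ne inj by auto
      show ?thesis
        by (simp add: 1 2 AC.id del: fun_upd_apply)
    qed
  qed
  then have "tree (ks @ [i, j]) f \<simeq> tree (ks @ [i, j]) ?g"
    unfolding tree_append by (rule tree_cong[OF inf])
  with tree_perm[OF inf perm] tree_perm[OF inf perm[symmetric]] show ?thesis
    by (blast intro: AC.Trans)
qed

text \<open>The type of a leaf. Since \<open>mset_set\<close> is empty on infinite sets, it is
  meaningful only for finite \<open>S\<close>.\<close>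

abbreviation labels :: "('v \<times> nat) set \<Rightarrow> 'v multiset" where
  "labels S \<equiv> image_mset fst (mset_set S)"

text \<open>The common part \<open>labels (S \<inter> R)\<close> cancels. Hence every coin in
  \<open>S - R\<close> has an equally labelled partner in \<open>R - S\<close>.\<close>

lemma labels_Diff_eq:
  assumes "finite S" "finite R" "labels S = labels R"
  shows "labels (S - R) = labels (R - S)"
proof -
  have "labels S = labels (S - R) + labels (S \<inter> R)" if "finite S" for S R :: "('a \<times> nat) set"
    using mset_set_Union[of "S - R" "S \<inter> R"] that
    by (simp add: Int_Diff_disjoint Un_Diff_Int Diff_Int_distrib2 flip: image_mset_union)
  from this[of S R] this[of R S] show ?thesis
    using assms by (simp add: Int_commute)
qed

text \<open>Replacing a coin \<open>i\<close> of \<open>S - R\<close> by an equally labelled coin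
  \<open>j\<close> of \<open>R - S\<close> gives a set \<open>Q\<close> of the same type that is
  closer to \<open>R\<close>. Leaves \<open>S\<close> and \<open>Q\<close> are exchanged by the
  previous step, leaves \<open>Q\<close> and \<open>R\<close> by induction.\<close>

lemma tree_exchange:
  assumes inf: "infinite (UNIV :: 'v set)" and "distinct is"
  shows "S \<subseteq> set is \<Longrightarrow> R \<subseteq> set is \<Longrightarrow> labels S = labels R \<Longrightarrow>
    tree is f \<simeq> (tree is (exchange f S R) :: 'v formula)"
proof (induction "card (S - R)" arbitrary: S f rule: less_induct)
  case less
  have fin: "finite S" "finite R"
    using less.prems finite_subset by auto
  have D: "labels (S - R) = labels (R - S)"
    using fin less.prems labels_Diff_eq by blast
  show ?case
  proof (cases "S - R = {}")
    case True
    with D have "R - S = {}"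
      using fin by (simp add: mset_set_empty_iff)
    with True have "S = R"
      by blast
    then show ?thesis
      by (simp add: AC.id)
  next
    case False
    then obtain i where i: "i \<in> S" "i \<notin> R"
      by blast
    then have "fst i \<in># labels (S - R)"
      using fin by auto
    then obtain j where j: "j \<in> R" "j \<notin> S" "fst i = fst j"
      unfolding D using fin by auto
    define S0 where "S0 = S - {i}"
    have S: "S = insert i S0" "i \<notin> S0" "j \<notin> S0" "i \<noteq> j" "finite S0" "S0 \<subseteq> set is"
      using i j fin less.prems by (auto simp: S0_def)
    define Q where "Q = insert j S0"
    have step: "tree is g \<simeq> tree is (exchange g S Q)" for g :: "_ \<Rightarrow> 'v formula"
      unfolding Q_def S(1) using S i j less.prems by (intro tree_exchange_step inf assms) auto
    have "S - R = insert i (Q - R)" "i \<notin> Q - R"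
      using S i j by (auto simp: Q_def)
    then have "card (Q - R) < card (S - R)"
      using fin S by (simp add: Q_def)
    moreover have "Q \<subseteq> set is" "labels Q = labels R"
      using S j less.prems by (auto simp: Q_def)
    ultimately have IH: "tree is g \<simeq> tree is (exchange g Q R)" for g :: "_ \<Rightarrow> 'v formula"
      using less.hyps less.prems by blast
    have ne: "S \<noteq> Q" "S \<noteq> R"
      using S i by (auto simp: Q_def)
    show ?thesis
    proof (cases "Q = R")
      case True
      with step show ?thesis by simp
    next
      case False
      \<comment> \<open>For distinct \<open>S\<close>, \<open>Q\<close>, \<open>R\<close>, the
        transposition of \<open>S\<close> and \<open>R\<close> is that of \<open>Q\<close> and
        \<open>R\<close> conjugated by that of \<open>S\<close> and \<open>Q\<close>.\<close>
      have "tree is f \<simeq> tree is (exchange f S Q)"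
        by (rule step)
      also have "\<dots> \<simeq> tree is (exchange (exchange f S Q) Q R)"
        by (rule IH)
      also have "\<dots> \<simeq> tree is (exchange (exchange (exchange f S Q) Q R) S Q)"
        by (rule step)
      also have "exchange (exchange (exchange f S Q) Q R) S Q = exchange f S R"
        using ne False by (auto simp: fun_eq_iff)
      finally show ?thesis .
    qed
  qed
qed

section \<open>Leaf counts determine the tree\<close>

abbreviation leaf :: "bool \<Rightarrow> 'v formula" where
  "leaf b \<equiv> (if b then Top else Bot)"

text \<open>Induction on the number of leaves where \<open>b\<close> and \<open>c\<close> disagree.
  Equal counts force disagreements of one type to occur in both directions, and exchanging two
  opposite ones repairs both.\<close>

lemma tree_eqI:
  assumes inf: "infinite (UNIV :: 'v set)" and "distinct is"
  shows "(\<And>t. card {S \<in> Pow (set is). b S \<and> labels S = t} = card {S \<in> Pow (set is). c S \<and> labels S = t})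
    \<Longrightarrow> tree is (\<lambda>S. leaf (b S)) \<simeq> (tree is (\<lambda>S. leaf (c S)) :: 'v formula)"
proof (induction "card {S \<in> Pow (set is). b S \<noteq> c S}" arbitrary: b rule: less_induct)
  case less
  let ?X = "\<lambda>b t. {S \<in> Pow (set is). b S \<and> labels S = t}"
  have fin: "finite (?X b t)" for b t
    by simp
  show ?case
  proof (cases "\<exists>S \<subseteq> set is. b S \<noteq> c S")
    case False
    then show ?thesis
      by (intro tree_cong[OF inf]) (auto intro: AC.id)
  next
    case True
    then obtain S0 where S0: "S0 \<subseteq> set is" "b S0 \<noteq> c S0"
      by blast
    define t where "t = labels S0"
    have ne: "?X b t \<noteq> ?X c t"
      using S0 by (auto simp: t_def)
    \<comment> \<open>Two different finite sets of equal cardinality: neither contains the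
      other.\<close>
    have "\<not> ?X b t \<subseteq> ?X c t" "\<not> ?X c t \<subseteq> ?X b t"
      using card_subset_eq[OF fin, of "?X b t" c t] card_subset_eq[OF fin, of "?X c t" b t]
        less.prems[of t] ne by auto
    then obtain S R where
      S: "S \<subseteq> set is" "b S" "\<not> c S" "labels S = t" and
      R: "R \<subseteq> set is" "\<not> b R" "c R" "labels R = t"
      by blast
    have "S \<noteq> R"
      using S R by blast
    define b' where "b' = b(S := False, R := True)"
    have card: "card (?X b' u) = card (?X b u)" for u
    proof (cases "u = t")
      case True
      have "?X b' t = insert R (?X b t - {S})"
        using S R by (auto simp: b'_def)
      moreover have "R \<notin> ?X b t" "S \<in> ?X b t"
        using S R by auto
      ultimately show ?thesis
        using True fin[of b t]
        by (metis (lifting) DiffD1 card_Suc_Diff1 card_insert_disjoint finite_Diff)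
    next
      case False
      then have "?X b' u = ?X b u"
        using S R by (auto simp: b'_def)
      then show ?thesis by simp
    qed
    have "{S \<in> Pow (set is). b' S \<noteq> c S} \<subset> {S \<in> Pow (set is). b S \<noteq> c S}"
      using S R \<open>S \<noteq> R\<close> by (auto simp: b'_def split: if_splits)
    then have "card {S \<in> Pow (set is). b' S \<noteq> c S} < card {S \<in> Pow (set is). b S \<noteq> c S}"
      by (intro psubset_card_mono) auto
    then have "tree is (\<lambda>S. leaf (b' S)) \<simeq> (tree is (\<lambda>S. leaf (c S)) :: 'v formula)"
      by (rule less.hyps) (metis card less.prems)
    moreover have "exchange (\<lambda>S. leaf (b S)) S R = (\<lambda>S. leaf (b' S) :: 'v formula)"
      using S R by (auto simp: b'_def fun_eq_iff)
    ultimately show ?thesis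
      using tree_exchange[OF inf \<open>distinct is\<close> S(1) R(1), of "\<lambda>S. leaf (b S)"] S R
      by (simp add: AC.Trans)
  qed
qed

section \<open>Normal forms\<close>

text \<open>The lower bound \<open>m\<close> on coin numbers is there for the induction: it lets the
  three parts of a conditional use disjoint sets of coins.\<close>

lemma ex_normal_form:
  fixes \<phi> :: "'v formula"
  assumes inf: "infinite (UNIV :: 'v set)"
  shows "\<exists>is b. distinct is \<and> (\<forall>i\<in>set is. m \<le> snd i) \<and> \<phi> \<simeq> tree is (\<lambda>S. leaf (b S))"
proof (induction \<phi> arbitrary: m)
  case (Var x)
  have "Var x \<simeq> tree [(x, m)] (\<lambda>S. leaf (S \<noteq> {}))"
    using AC.Sym[OF AC_vacuous] by simp
  then show ?case
    by (intro exI[of _ "[(x, m)]"] exI[of _ "\<lambda>S. S \<noteq> {}"]) simp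
next
  case Top
  show ?case
    by (rule exI[of _ "[]"], rule exI[of _ "\<lambda>_. True"]) (simp add: AC.id)
next
  case Bot
  show ?case
    by (rule exI[of _ "[]"], rule exI[of _ "\<lambda>_. False"]) (simp add: AC.id)
next
  case (Cond \<alpha> \<beta> \<gamma>)
  have bound: "\<exists>n. \<forall>i\<in>set is. snd i < n" for "is" :: "('v \<times> nat) list"
    using finite_nat_set_iff_bounded[of "snd ` set is"] by auto
  obtain "is" a where I: "distinct is" "\<forall>i\<in>set is. m \<le> snd i" "\<alpha> \<simeq> tree is (\<lambda>S. leaf (a S))"
    using Cond.IH(1) by blast
  obtain n where n: "\<forall>i\<in>set is. snd i < n"
    using bound by blast
  \<comment> \<open>Starting at \<open>max m n\<close> keeps the coins of \<open>\<beta>\<close>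
    apart from those of \<open>\<alpha>\<close>; the bound for \<open>\<gamma>\<close> below serves
    the same purpose.\<close>
  obtain js b where J: "distinct js" "\<forall>i\<in>set js. max m n \<le> snd i" "\<beta> \<simeq> tree js (\<lambda>S. leaf (b S))"
    using Cond.IH(2) by blast
  obtain k where k: "\<forall>i\<in>set js. snd i < k"
    using bound by blast
  obtain ks c where K: "distinct ks" "\<forall>i\<in>set ks. max (max m n) k \<le> snd i"
    "\<gamma> \<simeq> tree ks (\<lambda>S. leaf (c S))"
    using Cond.IH(3) by blast
  have disj: "set is \<inter> set js = {}" "set is \<inter> set ks = {}" "set js \<inter> set ks = {}"
    using n J(2) k K(2) by force+
  \<comment> \<open>All coins are tossed; those of \<open>\<alpha>\<close> decide whether the
    outcome is read off the coins of \<open>\<beta>\<close> or of \<open>\<gamma>\<close>.\<close>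
  define d where "d S = (if a (S \<inter> set is) then b (S \<inter> set js) else c (S \<inter> set ks))" for S
  have leaf: "Cond (leaf (a S)) \<beta> \<gamma> \<simeq> tree (js @ ks) (\<lambda>R. leaf (d (S \<union> R)))"
    if "S \<subseteq> set is" for S
  proof (cases "a S")
    case True
    \<comment> \<open>Below each leaf of \<open>\<beta>\<close> the coins of \<open>\<gamma>\<close>
      are tossed without effect.\<close>
    have "leaf (b R) \<simeq> tree ks (\<lambda>Q. leaf (d (S \<union> (R \<union> Q))))" if "R \<subseteq> set js" for R
    proof (rule AC.Trans[OF AC.Sym[OF tree_const[OF inf]] tree_cong[OF inf]])
      fix Q assume "Q \<subseteq> set ks"
      with that \<open>S \<subseteq> set is\<close> disj
      have "(S \<union> (R \<union> Q)) \<inter> set is = S" "(S \<union> (R \<union> Q)) \<inter> set js = R"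
        by blast+
      then show "leaf (b R) \<simeq> leaf (d (S \<union> (R \<union> Q)))"
        using True by (simp add: d_def AC.id)
    qed
    then have "tree js (\<lambda>R. leaf (b R)) \<simeq> tree (js @ ks) (\<lambda>R. leaf (d (S \<union> R)))"
      unfolding tree_append
      by (intro tree_cong[OF inf])
    moreover have "Cond (leaf (a S)) \<beta> \<gamma> \<simeq> \<beta>"
      using True AC_always[OF inf] by simp
    ultimately show ?thesis
      using J(3) by (blast intro: AC.Trans)
  next
    case False
    have "tree ks (\<lambda>Q. leaf (c Q)) \<simeq> tree ks (\<lambda>Q. leaf (d (S \<union> (R \<union> Q))))"
      if "R \<subseteq> set js" for R
    proof (rule tree_cong[OF inf])
      fix Q assume "Q \<subseteq> set ks"
      with that \<open>S \<subseteq> set is\<close> disj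
      have "(S \<union> (R \<union> Q)) \<inter> set is = S" "(S \<union> (R \<union> Q)) \<inter> set ks = Q"
        by blast+
      then show "leaf (c Q) \<simeq> leaf (d (S \<union> (R \<union> Q)))"
        using False by (simp add: d_def AC.id)
    qed
    then have "tree js (\<lambda>R. tree ks (\<lambda>Q. leaf (c Q))) \<simeq> tree (js @ ks) (\<lambda>R. leaf (d (S \<union> R)))"
      unfolding tree_append by (rule tree_cong[OF inf])
    \<comment> \<open>Here the coins of \<open>\<beta>\<close> are tossed first, without
      effect.\<close>
    then have "tree ks (\<lambda>Q. leaf (c Q)) \<simeq> tree (js @ ks) (\<lambda>R. leaf (d (S \<union> R)))"
      by (rule AC.Trans[OF AC.Sym[OF tree_const[OF inf]]])
    moreover have "Cond (leaf (a S)) \<beta> \<gamma> \<simeq> \<gamma>"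
      using False AC_never[OF inf] by simp
    ultimately show ?thesis
      using K(3) by (blast intro: AC.Trans)
  qed
  have "Cond \<alpha> \<beta> \<gamma> \<simeq> Cond (tree is (\<lambda>S. leaf (a S))) \<beta> \<gamma>"
    by (intro AC_Cond[OF inf] I AC.id)
  also have "\<dots> \<simeq> tree is (\<lambda>S. Cond (leaf (a S)) \<beta> \<gamma>)"
    by (rule Cond_tree[OF inf])
  also have "\<dots> \<simeq> tree (is @ js @ ks) (\<lambda>S. leaf (d S))"
    unfolding tree_append[of "is"] by (intro tree_cong[OF inf] leaf)
  finally have "Cond \<alpha> \<beta> \<gamma> \<simeq> tree (is @ js @ ks) (\<lambda>S. leaf (d S))" .
  moreover have "distinct (is @ js @ ks)" "\<forall>i\<in>set (is @ js @ ks). m \<le> snd i"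
    using I J K disj by auto
  ultimately show ?case
    by blast
qed

text \<open>Each formula is expanded over its own coins, disjoint from those of the other, and then
  padded with the other's coins by ignoring their outcome.\<close>

lemma ex_common_normal_form:
  fixes \<phi> \<psi> :: "'v formula"
  assumes inf: "infinite (UNIV :: 'v set)"
  shows "\<exists>is b c. distinct is \<and> \<phi> \<simeq> tree is (\<lambda>S. leaf (b S)) \<and> \<psi> \<simeq> tree is (\<lambda>S. leaf (c S))"
proof -
  obtain "is" b where I: "distinct is" "\<phi> \<simeq> tree is (\<lambda>S. leaf (b S))"
    using ex_normal_form[OF inf, of 0 \<phi>] by blast
  obtain n where n: "\<forall>i\<in>set is. snd i < n"
    using finite_nat_set_iff_bounded[of "snd ` set is"] by auto
  obtain js c where J: "distinct js" "\<forall>i\<in>set js. n \<le> snd i" "\<psi> \<simeq> tree js (\<lambda>S. leaf (c S))"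
    using ex_normal_form[OF inf, of n \<psi>] by blast
  have disj: "set is \<inter> set js = {}"
    using n J(2) by force
  have b: "tree is (\<lambda>S. leaf (b S)) \<simeq> tree (is @ js) (\<lambda>S. leaf (b (S \<inter> set is)))"
    unfolding tree_append
  proof (rule tree_cong[OF inf])
    fix S assume S: "S \<subseteq> set is"
    have "(S \<union> R) \<inter> set is = S" if "R \<subseteq> set js" for R
      using S that disj by blast
    then have "tree js (\<lambda>R. leaf (b S)) \<simeq> tree js (\<lambda>R. leaf (b ((S \<union> R) \<inter> set is)))"
      by (intro tree_cong[OF inf]) (simp add: AC.id)
    then show "leaf (b S) \<simeq> tree js (\<lambda>R. leaf (b ((S \<union> R) \<inter> set is)))"
      by (rule AC.Trans[OF AC.Sym[OF tree_const[OF inf]]])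
  qed
  have "tree is (\<lambda>S. tree js (\<lambda>R. leaf (c R))) \<simeq> tree (is @ js) (\<lambda>S. leaf (c (S \<inter> set js)))"
    unfolding tree_append
  proof (intro tree_cong[OF inf])
    fix S R assume "S \<subseteq> set is" "R \<subseteq> set js"
    then have "(S \<union> R) \<inter> set js = R"
      using disj by blast
    then show "leaf (c R) \<simeq> leaf (c ((S \<union> R) \<inter> set js))"
      by (simp add: AC.id)
  qed
  then have c: "tree js (\<lambda>S. leaf (c S)) \<simeq> tree (is @ js) (\<lambda>S. leaf (c (S \<inter> set js)))"
    by (rule AC.Trans[OF AC.Sym[OF tree_const[OF inf]]])
  have "distinct (is @ js)"
    using I J disj by auto
  with AC.Trans[OF I(2) b] AC.Trans[OF J(3) c] show ?thesis
    by (intro exI[of _ "is @ js"] exI conjI)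
qed

section \<open>Recovering the leaf counts from probabilities\<close>

text \<open>The variable \<open>v\<close> becomes true with odds \<open>z ^ w v\<close>. Up to the factor in front, which does not
  depend on the leaves, the probability of a tree is then a polynomial in \<open>z\<close>.\<close>

lemma prob_tree_odds:
  fixes z :: real
  assumes "z \<ge> 0" "distinct is"
  shows "(\<Prod>i\<in>set is. 1 + z ^ w (fst i)) * prob (\<lambda>v. z ^ w v / (1 + z ^ w v)) (tree is f) =
    (\<Sum>S\<in>Pow (set is). z ^ (\<Sum>i\<in>S. w (fst i)) * prob (\<lambda>v. z ^ w v / (1 + z ^ w v)) (f S))"
  using \<open>distinct is\<close>
proof (induction "is" arbitrary: f)
  case (Cons i "is")
  let ?P = "\<lambda>v. z ^ w v / (1 + z ^ w v)" and ?C = "\<Prod>i\<in>set is. 1 + z ^ w (fst i)"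
  let ?u = "z ^ w (fst i)"
  let ?m = "\<lambda>S. z ^ (\<Sum>i\<in>S. w (fst i))"
  have "?u \<ge> 0"
    using \<open>z \<ge> 0\<close> by simp
  \<comment> \<open>After scaling by \<open>1 + ?u\<close>, heads contributes the factor
    \<open>?u\<close> and tails the factor \<open>1\<close>.\<close>
  then have u: "(1 + ?u) * ?P (fst i) = ?u" "(1 + ?u) * (1 - ?P (fst i)) = 1"
    by (simp_all add: field_simps)
  have i: "i \<notin> set is" "distinct is"
    using Cons.prems by auto
  have "(\<Prod>i\<in>set (i # is). 1 + z ^ w (fst i)) * prob ?P (tree (i # is) f) =
    (1 + ?u) * ?P (fst i) * (?C * prob ?P (tree is (\<lambda>S. f (insert i S)))) +
    (1 + ?u) * (1 - ?P (fst i)) * (?C * prob ?P (tree is f))"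
    using i by (simp add: algebra_simps)
  also have "\<dots> = ?u * (\<Sum>S\<in>Pow (set is). ?m S * prob ?P (f (insert i S))) +
    (\<Sum>S\<in>Pow (set is). ?m S * prob ?P (f S))"
    unfolding u Cons.IH[OF i(2)] by simp
  also have "?u * (\<Sum>S\<in>Pow (set is). ?m S * prob ?P (f (insert i S))) =
    (\<Sum>S\<in>Pow (set is). ?m (insert i S) * prob ?P (f (insert i S)))"
    unfolding sum_distrib_left
  proof (rule sum.cong)
    fix S assume "S \<in> Pow (set is)"
    then have "finite S" "i \<notin> S"
      using i finite_subset by auto
    then show "?u * (?m S * prob ?P (f (insert i S))) = ?m (insert i S) * prob ?P (f (insert i S))"
      by (simp add: power_add)
  qed simp
  \<comment> \<open>These are the heads sets containing \<open>i\<close>; the remaining sum runs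
    over those without \<open>i\<close>.\<close>
  also have "\<dots> = (\<Sum>S\<in>insert i ` Pow (set is). ?m S * prob ?P (f S))"
    using i by (subst sum.reindex) (auto intro!: inj_onI simp: insert_ident)
  also have "\<dots> + (\<Sum>S\<in>Pow (set is). ?m S * prob ?P (f S)) =
    (\<Sum>S\<in>Pow (set (i # is)). ?m S * prob ?P (f S))"
    using i by (subst sum.union_disjoint[symmetric]) (auto simp: Pow_insert Un_commute)
  finally show ?case .
qed simp

text \<open>Kronecker substitution: powers of a large base as weights separate monomials of bounded degree.\<close>

lemma ex_separating_weights:
  assumes "finite A"
  shows "\<exists>w :: 'v \<Rightarrow> nat. inj_on (\<lambda>M. \<Sum>v\<in>#M. w v) {M. set_mset M \<subseteq> A \<and> size M \<le> n}"
  using assms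
proof (induction A)
  case (insert a A)
  then obtain w :: "'v \<Rightarrow> nat"
    where w: "inj_on (\<lambda>M. \<Sum>v\<in>#M. w v) {M. set_mset M \<subseteq> A \<and> size M \<le> n}"
    by blast
  \<comment> \<open>In base \<open>Suc n\<close>, the last digit of the total weight is the
    multiplicity of \<open>a\<close>, which is at most \<open>n\<close>; the quotient is the old
    weight of the rest.\<close>
  define w' where "w' v = (if v = a then 1 else Suc n * w v)" for v
  let ?r = "\<lambda>M. filter_mset (\<lambda>v. v \<noteq> a) M"
  have split: "(\<Sum>v\<in>#M. w' v) = count M a + Suc n * (\<Sum>v\<in>#?r M. w v)" for M
    by (induction M) (auto simp: w'_def algebra_simps)
  have "M = N" if MN: "set_mset M \<subseteq> insert a A" "size M \<le> n" "set_mset N \<subseteq> insert a A" "size N \<le> n"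
    and eq: "(\<Sum>v\<in>#M. w' v) = (\<Sum>v\<in>#N. w' v)" for M N
  proof -
    have lt: "count M a < Suc n" "count N a < Suc n"
      using MN count_le_size by (metis le_imp_less_Suc le_trans)+
    have *: "count M a + Suc n * (\<Sum>v\<in>#?r M. w v) = count N a + Suc n * (\<Sum>v\<in>#?r N. w v)"
      using eq by (simp only: split)
    have c: "count M a = count N a"
      using lt arg_cong[OF *, of "\<lambda>k. k mod Suc n"] by (simp del: mult_Suc)
    have s: "(\<Sum>v\<in>#?r M. w v) = (\<Sum>v\<in>#?r N. w v)"
      using * unfolding c by (simp del: mult_Suc)
    have "size (?r M) \<le> n" "size (?r N) \<le> n"
      using MN size_filter_mset_lesseq le_trans by blast+
    then have r: "?r M = ?r N"
      using MN by (intro inj_onD[OF w s]) auto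
    show ?thesis
    proof (rule multiset_eqI)
      show "count M v = count N v" for v
        using c arg_cong[OF r, of "\<lambda>K. count K v"] by (cases "v = a") auto
    qed
  qed
  then have "inj_on (\<lambda>M. \<Sum>v\<in>#M. w' v) {M. set_mset M \<subseteq> insert a A \<and> size M \<le> n}"
    by (auto intro!: inj_onI)
  then show ?case
    by blast
qed (auto intro!: exI inj_onI)

text \<open>The difference of the two sums is a polynomial in \<open>z\<close> with infinitely many
  roots, so it is zero; its coefficient at exponent \<open>n\<close> is the difference of the two
  cardinalities.\<close>

lemma sum_powers_eq_imp_card_eq:
  fixes e :: "'a \<Rightarrow> nat"
  assumes "finite A" "finite B"
    and eq: "\<And>z :: real. z \<ge> 0 \<Longrightarrow> (\<Sum>a\<in>A. z ^ e a) = (\<Sum>b\<in>B. z ^ e b)"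
  shows "card {a \<in> A. e a = n} = card {b \<in> B. e b = n}"
proof -
  \<comment> \<open>Including \<open>n\<close> itself keeps the exponent \<open>n\<close> in range
    even if \<open>e\<close> never takes that value.\<close>
  define N where "N = Max (insert n (e ` (A \<union> B)))"
  have N: "n \<le> N" "\<And>a. a \<in> A \<Longrightarrow> e a \<le> N" "\<And>b. b \<in> B \<Longrightarrow> e b \<le> N"
    using assms by (auto simp: N_def)
  define c where "c k = real (card {a \<in> A. e a = k}) - real (card {b \<in> B. e b = k})" for k
  have group: "(\<Sum>x\<in>X. z ^ e x) = (\<Sum>k\<le>N. real (card {x \<in> X. e x = k}) * z ^ k)"
    if "finite X" "\<And>x. x \<in> X \<Longrightarrow> e x \<le> N" for X and z :: real
  proof -
    have "(\<Sum>x\<in>X. z ^ e x) = (\<Sum>k\<le>N. \<Sum>x\<in>{x \<in> X. e x = k}. z ^ e x)"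
      using that by (intro sum.group[symmetric]) auto
    also have "\<dots> = (\<Sum>k\<le>N. real (card {x \<in> X. e x = k}) * z ^ k)"
      by (intro sum.cong) auto
    finally show ?thesis .
  qed
  have "(\<Sum>k\<le>N. c k * z ^ k) = 0" if "z \<ge> 0" for z
    using eq[OF that] group[OF assms(1) N(2)] group[OF assms(2) N(3)]
    by (simp add: c_def left_diff_distrib sum_subtractf)
  then have "{0..} \<subseteq> {z. (\<Sum>k\<le>N. c k * z ^ k) = 0}"
    by auto
  then have "infinite {z. (\<Sum>k\<le>N. c k * z ^ k) = 0}"
    using infinite_Ici infinite_super by blast
  then have "c n = 0"
    using polyfun_finite_roots[of c N] N(1) by blast
  then show ?thesis
    by (simp add: c_def)
qed

section \<open>Completeness by comparing leaf counts\<close>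

theorem theorem1:
  fixes \<phi> \<psi> :: "'v formula"
  assumes "infinite (UNIV :: 'v set)"
    and "sem_equiv \<phi> \<psi>"
  shows "\<phi> \<simeq> \<psi>"
proof -
  note inf = assms(1)
  obtain "is" b c where "is": "distinct is"
    and b: "\<phi> \<simeq> tree is (\<lambda>S. leaf (b S))" and c: "\<psi> \<simeq> tree is (\<lambda>S. leaf (c S))"
    using ex_common_normal_form[OF inf] by blast
  \<comment> \<open>Types of leaves use only labels of coins in \<open>is\<close> and have size at
    most \<open>length is\<close>, so on them the total weight \<open>e\<close> determines the
    type.\<close>
  obtain w :: "'v \<Rightarrow> nat" where
    w: "inj_on (\<lambda>M. \<Sum>v\<in>#M. w v) {M. set_mset M \<subseteq> fst ` set is \<and> size M \<le> length is}"
    using ex_separating_weights[of "fst ` set is"] by blast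
  define e where "e S = (\<Sum>i\<in>S. w (fst i))" for S :: "('v \<times> nat) set"
  have e: "e S = e R \<longleftrightarrow> labels S = labels R" if "S \<subseteq> set is" "R \<subseteq> set is" for S R
  proof -
    have *: "set_mset (labels S) \<subseteq> fst ` set is \<and> size (labels S) \<le> length is" if "S \<subseteq> set is" for S
      using that finite_subset[OF that] card_mono[OF _ that] card_length[of "is"] by auto
    have "e S = (\<Sum>v\<in>#labels S. w v)" for S
      by (simp add: e_def sum_unfold_sum_mset multiset.map_comp o_def)
    with inj_on_eq_iff[OF w] *[OF that(1)] *[OF that(2)] show ?thesis
      by simp
  qed
  let ?X = "\<lambda>b. {S \<in> Pow (set is). b S}"
  have "(\<Sum>S\<in>?X b. z ^ e S) = (\<Sum>S\<in>?X c. z ^ e S)" if "z \<ge> 0" for z :: real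
  proof -
    let ?P = "\<lambda>v. z ^ w v / (1 + z ^ w v)"
    have "valuation ?P"
      using that by (auto simp: valuation_def divide_le_eq_1 add_nonneg_nonneg intro: add_pos_nonneg)
    then have "prob ?P (tree is (\<lambda>S. leaf (b S))) = prob ?P (tree is (\<lambda>S. leaf (c S)))"
      using assms(2) AC_sound[OF b] AC_sound[OF c] by (simp add: sem_equiv_def)
    \<comment> \<open>Leaves have probability \<open>1\<close> or \<open>0\<close>, so only the
      \<open>Top\<close> leaves survive in the sum over all heads sets.\<close>
    moreover have "(\<Sum>S\<in>?X d. z ^ e S) =
      (\<Prod>i\<in>set is. 1 + z ^ w (fst i)) * prob ?P (tree is (\<lambda>S. leaf (d S)))" for d
      unfolding prob_tree_odds[OF that "is"] e_def[symmetric]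
      by (subst sum.inter_filter) (auto intro: sum.cong)
    ultimately show ?thesis
      by simp
  qed
  then have card: "card {S \<in> ?X b. e S = n} = card {S \<in> ?X c. e S = n}" for n
    by (intro sum_powers_eq_imp_card_eq) auto
  have "card {S \<in> Pow (set is). b S \<and> labels S = t} = card {S \<in> Pow (set is). c S \<and> labels S = t}" for t
  proof (cases "\<exists>R \<subseteq> set is. labels R = t")
    case True
    then obtain R where R: "R \<subseteq> set is" "labels R = t"
      by blast
    have "{S \<in> Pow (set is). d S \<and> labels S = t} = {S \<in> ?X d. e S = e R}" for d
      using e[OF _ R(1)] R(2) by auto
    with card show ?thesis
      by simp
  \<comment> \<open>A type realized by no heads set has count zero on both sides.\<close>
  next
    case False
    then have "{S \<in> Pow (set is). d S \<and> labels S = t} = {}" for d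
      by blast
    then show ?thesis
      by (simp only:)
  qed
  then have "tree is (\<lambda>S. leaf (b S)) \<simeq> tree is (\<lambda>S. leaf (c S))"
    by (rule tree_eqI[OF inf "is"])
  with b c show ?thesis
    by (blast intro: AC.Trans AC.Sym)
qed

end
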